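(* Let $m\ge 2$ and $h\ge 1$ be integers, let $a_1,\dots,a_{m-1}\ge 0$ be integers, and let $$P(z)=1+z^{h+a_1}+z^{2h+a_1+a_2}+\cdots+z^{(m-1)h+a_1+a_2+\cdots+a_{m-1}}.$$ If $w\in\mathbb{C}$ is a zero of $P$, then $$\left(\tfrac12\right)^{1/h}\le |w|\le 2^{1/h}.$$ *)

theory Defs
  imports Complex_Main "HOL-Computational_Algebra.Polynomial"
begin

(* The sequence a is indexed from 1: only a 1, ..., a (m - 1) are used. The term k = 0 is 1. *)
definition gap_poly :: "nat \<Rightarrow> nat \<Rightarrow> (nat \<Rightarrow> nat) \<Rightarrow> complex poly" where
  "gap_poly m h a = (\<Sum>k<m. monom 1 (k * h + (\<Sum>i=1..k. a i)))"

end

theory Submission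
  imports Defs
begin

text \<open>
  Consecutive exponents of \<open>P\<close> differ by at least \<open>h\<close>. Hence if \<open>\<bar>w\<bar>\<^sup>h \<ge> 2\<close>, each term of \<open>P(w)\<close> is at
  least twice as large in modulus as the one before it, and since \<open>1 + 2 + \<dots> + 2\<^sup>n\<^sup>-\<^sup>1 < 2\<^sup>n\<close> the last
  term exceeds the sum of all others, so that \<open>P(w) \<noteq> 0\<close> (\<open>sum_nonzero_if_norm_doubling\<close>).
  If instead \<open>\<bar>w\<bar>\<^sup>h \<le> 1/2\<close> and \<open>w \<noteq> 0\<close>, the same holds with the terms taken in reverse order,
  the dominating term now being the constant \<open>1\<close>; and \<open>P(0) = 1\<close>. So every zero satisfies
  \<open>1/2 < \<bar>w\<bar>\<^sup>h < 2\<close>, and taking \<open>h\<close>-th roots gives the bounds.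
\<close>

text \<open>
  The induction rests on \<open>x\<^sub>0 + \<dots> + x\<^sub>n < 2 x\<^sub>n \<le> x\<^sub>n\<^sub>+\<^sub>1\<close>.
\<close>

lemma sum_less_if_doubling:
  fixes x :: "nat \<Rightarrow> real"
  assumes "0 < x 0" and "\<And>k. k < n \<Longrightarrow> 2 * x k \<le> x (Suc k)"
  shows "(\<Sum>k<n. x k) < x n"
  using assms(2)
proof (induction n)
  case 0
  then show ?case using assms(1) by simp
next
  case (Suc n)
  have "(\<Sum>k<n. x k) < x n" using Suc by simp
  moreover have "2 * x n \<le> x (Suc n)" using Suc.prems by simp
  ultimately show ?case by simp
qed

lemma sum_nonzero_if_norm_doubling:
  fixes z :: "nat \<Rightarrow> 'a::real_normed_vector"
  assumes "z 0 \<noteq> 0" and "\<And>k. k < n \<Longrightarrow> 2 * norm (z k) \<le> norm (z (Suc k))"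
  shows "(\<Sum>k<Suc n. z k) \<noteq> 0"
proof
  assume "(\<Sum>k<Suc n. z k) = 0"
  then have "z n = - (\<Sum>k<n. z k)" by (simp add: add_eq_0_iff)
  then have "norm (z n) \<le> (\<Sum>k<n. norm (z k))" by (simp add: norm_sum)
  also have "\<dots> < norm (z n)"
    using assms by (intro sum_less_if_doubling) auto
  finally show False by simp
qed

text \<open>
  The two bounds are the two directions of reading the sum: if \<open>\<bar>w\<bar>\<^sup>h \<ge> 2\<close> the terms double upwards,
  and if \<open>\<bar>w\<bar>\<^sup>h \<le> 1/2\<close> they double when read from the last to the first.
\<close>

lemma norm_zero_of_gap_sum_bounds:
  fixes w :: "'a::real_normed_field" and e :: "nat \<Rightarrow> nat"
  assumes gap: "\<And>k. e k + h \<le> e (Suc k)"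
    and w: "w \<noteq> 0"
    and zero: "(\<Sum>k<Suc n. w ^ e k) = 0"
  shows "1/2 < norm w ^ h" and "norm w ^ h < 2"
proof -
  have step: "norm w ^ e (Suc k) = norm w ^ e k * norm w ^ h * norm w ^ (e (Suc k) - e k - h)" for k
    using gap[of k] by (simp flip: power_add)
  show "norm w ^ h < 2"
  proof (rule ccontr)
    assume "\<not> norm w ^ h < 2"
    then have h2: "2 \<le> norm w ^ h" by simp
    have "1 \<le> norm w"
    proof (rule ccontr)
      assume "\<not> 1 \<le> norm w"
      then have "norm w ^ h \<le> 1" by (simp add: power_le_one)
      with h2 show False by simp
    qed
    have "2 * norm (w ^ e k) \<le> norm (w ^ e (Suc k))" for k
    proof -
      have "norm w ^ e k * 2 * 1
          \<le> norm w ^ e k * norm w ^ h * norm w ^ (e (Suc k) - e k - h)"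
        using h2 \<open>1 \<le> norm w\<close> by (intro mult_mono one_le_power) auto
      then show ?thesis unfolding norm_power step by simp
    qed
    then have "(\<Sum>k<Suc n. w ^ e k) \<noteq> 0"
      using w by (intro sum_nonzero_if_norm_doubling) auto
    with zero show False by simp
  qed
  show "1/2 < norm w ^ h"
  proof (rule ccontr)
    assume "\<not> 1/2 < norm w ^ h"
    then have h2: "norm w ^ h \<le> 1/2" by simp
    have "norm w \<le> 1"
    proof (rule ccontr)
      assume "\<not> norm w \<le> 1"
      then have "1 \<le> norm w ^ h" by (simp add: one_le_power)
      with h2 show False by simp
    qed
    have half: "2 * norm (w ^ e (Suc k)) \<le> norm (w ^ e k)" for k
    proof -
      have "norm w ^ e k * norm w ^ h * norm w ^ (e (Suc k) - e k - h)
          \<le> norm w ^ e k * (1/2) * 1"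
        using h2 \<open>norm w \<le> 1\<close> by (intro mult_mono power_le_one) auto
      then show ?thesis unfolding norm_power step by simp
    qed
    have "(\<Sum>k<Suc n. w ^ e (n - k)) \<noteq> 0"
    proof (rule sum_nonzero_if_norm_doubling)
      show "2 * norm (w ^ e (n - k)) \<le> norm (w ^ e (n - Suc k))" if "k < n" for k
        using half[of "n - Suc k"] that by (simp add: Suc_diff_Suc)
    qed (use w in simp)
    moreover have "(\<Sum>k<Suc n. w ^ e (n - k)) = (\<Sum>k<Suc n. w ^ e k)"
      using sum.nat_diff_reindex[of "\<lambda>k. w ^ e k" "Suc n"] by simp
    ultimately show False using zero by simp
  qed
qed

theorem mainTheorem8:
  fixes m h :: nat and a :: "nat \<Rightarrow> nat" and w :: complex
  assumes "m \<ge> 2" and "h \<ge> 1"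
    and "poly (gap_poly m h a) w = 0"
  shows "(1/2) powr (1 / real h) \<le> cmod w \<and> cmod w \<le> 2 powr (1 / real h)"
proof -
  define e where "e = (\<lambda>k. k * h + (\<Sum>i=1..k. a i))"
  obtain n where m: "m = Suc n" using assms(1) by (cases m) auto
  have zero: "(\<Sum>k<Suc n. w ^ e k) = 0"
    using assms(3) by (simp add: gap_poly_def e_def m poly_sum poly_monom)
  have gap: "e k + h \<le> e (Suc k)" for k by (simp add: e_def)
  have "w \<noteq> 0"
  proof
    assume "w = 0"
    have "e 0 = 0" by (simp add: e_def)
    moreover have "w ^ e (Suc k) = 0" for k
      using gap[of k] assms(2) \<open>w = 0\<close> by (simp add: power_0_left)
    ultimately have "(\<Sum>k<Suc n. w ^ e k) = 1"
      unfolding sum.lessThan_Suc_shift by (simp only: power_0 sum.neutral_const add_0_right)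
    with zero show False by simp
  qed
  note bounds = norm_zero_of_gap_sum_bounds[OF gap \<open>w \<noteq> 0\<close> zero]
  have root: "(cmod w ^ h) powr (1 / real h) = cmod w"
    using \<open>w \<noteq> 0\<close> assms(2) by (simp add: powr_powr flip: powr_realpow)
  have "(1/2) powr (1 / real h) \<le> (cmod w ^ h) powr (1 / real h)"
    using bounds(1) by (intro powr_mono2) auto
  moreover have "(cmod w ^ h) powr (1 / real h) \<le> 2 powr (1 / real h)"
    using bounds(2) by (intro powr_mono2) auto
  ultimately show ?thesis unfolding root by simp
qed

end
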